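(* For integers $n, m \geq 0$, let $D_{2,2}(n, m)$ be the number of partitions of $n$ into $m$ parts $\lambda_1 \leq \cdots \leq \lambda_m$ such that $\lambda_{i+1} - \lambda_i \geq 2$ for all $i$, and $\lambda_{i+1} - \lambda_i \geq 3$ unless $\lambda_i$ and $\lambda_{i+1}$ are both odd. Let $D_{2,1}(n, m)$ be the number of such partitions (counted by $D_{2,2}(n,m)$) in which the smallest part is at least $3$. Then \[ \sum_{m, n \geq 0} D_{2,2}(n, m) q^n x^m = \sum_{n_1, n_2 \geq 0} \frac{ q^{4n_2^2 + (3n_1^2 - n_1)/2 + 4n_2 n_1} x^{2n_2 + n_1} }{ (q; q)_{n_1} (q^4; q^4)_{n_2} }, \] \[ \sum_{m, n \geq 0} D_{2,1}(n, m) q^n x^m = \sum_{n_1, n_2 \geq 0} \frac{ q^{4n_2^2 + 4n_2 + (3n_1^2 + 3n_1)/2 + 4n_2 n_1} x^{2n_2 + n_1} }{ (q; q)_{n_1} (q^4; q^4)_{n_2} }. \]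
   Context: A partition of $n$ into $m$ parts is a non-decreasing sequence of $m$ positive integers summing to $n$. For $n \geq 0$, $(a; q)_n = \prod_{j=1}^{n} (1 - a q^{j-1})$, with the empty product equal to $1$. *)

theory Defs
  imports "HOL-Analysis.Analysis" "HOL-Computational_Algebra.Formal_Power_Series"
begin

definition partitions_into :: "nat \<Rightarrow> nat \<Rightarrow> nat list set" where
  "partitions_into n m =
     {ps. length ps = m \<and> sum_list ps = n \<and> sorted ps \<and> (\<forall>p\<in>set ps. p > 0)}"

text \<open>Differences are written additively, so natural-number subtraction plays no role.\<close>

definition parts_D22 :: "nat \<Rightarrow> nat \<Rightarrow> nat list set" where
  "parts_D22 n m =
     {ps \<in> partitions_into n m.
        \<forall>i. Suc i < m \<longrightarrow>
          ps ! Suc i \<ge> ps ! i + 2 \<and>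
          (\<not> (odd (ps ! i) \<and> odd (ps ! Suc i)) \<longrightarrow> ps ! Suc i \<ge> ps ! i + 3)}"

definition D22 :: "nat \<Rightarrow> nat \<Rightarrow> nat" where
  "D22 n m = card (parts_D22 n m)"

text \<open>The bound on the smallest part is vacuous for the empty partition, so \<open>D21 0 0 = 1\<close>.\<close>

definition D21 :: "nat \<Rightarrow> nat \<Rightarrow> nat" where
  "D21 n m = card {ps \<in> parts_D22 n m. \<forall>p\<in>set ps. p \<ge> 3}"

lemma finite_parts_D22: "finite (parts_D22 n m)"
proof (rule finite_subset)
  show "parts_D22 n m \<subseteq> {xs. set xs \<subseteq> {..n} \<and> length xs = m}"
    by (auto simp: parts_D22_def partitions_into_def dest: member_le_sum_list)
  show "finite {xs. set xs \<subseteq> {..n} \<and> length xs = m}"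
    by (rule finite_lists_length_eq) simp
qed

definition q_poch :: "'a :: comm_ring_1 \<Rightarrow> 'a \<Rightarrow> nat \<Rightarrow> 'a" where
  "q_poch a q n = (\<Prod>j=1..n. 1 - a * q ^ (j - 1))"

text \<open>
  Formal power series in \<open>q\<close> and \<open>x\<close> are modelled as series in \<open>q\<close> whose coefficients are
  series in \<open>x\<close>. The metric on the outer series type is the \<open>q\<close>-adic one, and with respect to it
  all infinite sums considered here converge: only finitely many terms contribute to each power
  of \<open>q\<close>. (With the variables nested the other way round, the sums over partitions would not.)
\<close>

abbreviation var_q :: "rat fps fps" where
  "var_q \<equiv> fps_X"

abbreviation var_x :: "rat fps fps" where
  "var_x \<equiv> fps_const fps_X"

text \<open>
  The coefficient type \<open>rat fps\<close> is not a field, but all denominators below have constant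
  coefficient \<open>1\<close>, and for these \<open>/\<close> is genuine division:
\<close>

lemma fps_fps_divide_mult_cancel:
  fixes f g :: "rat fps fps"
  assumes "fps_nth g 0 = 1"
  shows "f / g * g = f"
proof -
  have s: "subdegree g = 0"
    using assms by (intro subdegreeI) auto
  have "fps_right_inverse g 1 = inverse g"
    unfolding fps_inverse_def[of g] using assms by simp
  moreover have "g * fps_right_inverse g 1 = 1"
    using assms by (intro fps_right_inverse) auto
  ultimately have "g * inverse g = 1"
    by simp
  then show ?thesis
    using s by (simp add: fps_divide_def mult.assoc mult.commute[of _ g])
qed

end

theory Submission
  imports Defs
begin

text \<open>
  Let \<open>A\<^sub>m(q)\<close> be the coefficient of \<open>x\<^sup>m\<close> in the first series. Subtracting an even number from
  all parts preserves the gap condition, so the partitions with smallest part at least \<open>3\<close>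
  contribute \<open>q\<^bsup>2m\<^esup> A\<^sub>m\<close>, which reduces the second identity to the first. Splitting by whether the
  smallest part is \<open>1\<close>, \<open>2\<close> or at least \<open>3\<close> gives
  \<open>(1 - q\<^bsup>2m\<^esup>) A\<^sub>m = q\<^bsup>2m-1\<^esup> (1 + q\<^bsup>2m-1\<^esup>) A\<^bsub>m-1\<^esub>\<close>.

  On the other side, \<open>4n\<^sub>2\<^sup>2 + (3n\<^sub>1\<^sup>2 - n\<^sub>1)/2 + 4n\<^sub>1n\<^sub>2 = m\<^sup>2 + n\<^sub>1(n\<^sub>1 - 1)/2\<close> for \<open>m = n\<^sub>1 + 2n\<^sub>2\<close>, so after
  division by \<open>q\<^bsup>m\<^sup>2\<^esup>\<close> the coefficient of \<open>x\<^sup>m\<close> is that of \<open>z\<^sup>m\<close> in \<open>F(z) G(z)\<close>, where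
  \<open>F(z) = \<Sum> q\<^bsup>n(n-1)/2\<^esup> z\<^sup>n / (q; q)\<^sub>n\<close> and \<open>G(z) = \<Sum> z\<^bsup>2n\<^esup> / (q\<^sup>4; q\<^sup>4)\<^sub>n\<close>. From
  \<open>F(z) = (1 + z)(1 + qz) F(q\<^sup>2z)\<close> and \<open>(1 - z\<^sup>2) G(z) = G(q\<^sup>2z)\<close> one gets
  \<open>(1 - z) F(z) G(z) = (1 + qz) F(q\<^sup>2z) G(q\<^sup>2z)\<close>, which is the same recurrence.
\<close>

unbundle no vec_syntax
unbundle fps_syntax

section \<open>The gap condition and even shifts of partitions\<close>

definition D_gap :: "nat \<Rightarrow> nat \<Rightarrow> bool" where
  "D_gap a b \<longleftrightarrow> b \<ge> a + 2 \<and> (\<not> (odd a \<and> odd b) \<longrightarrow> b \<ge> a + 3)"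

text \<open>Two gaps of at least 2 add up to at least 4, which meets both clauses. Hence the
  condition on neighbours can be imposed on all pairs by \<open>sorted_wrt\<close>, where it passes
  easily through \<open>(#)\<close> and \<open>map\<close>.\<close>

lemma transp_D_gap: "transp D_gap"
  by (rule transpI) (auto simp: D_gap_def)

lemma D_gap_add_even: "even k \<Longrightarrow> D_gap (a + k) (b + k) \<longleftrightarrow> D_gap a b"
  by (auto simp: D_gap_def)

text \<open>An even \<open>b \<ge> 3\<close> is at least 4, so parity adds nothing after a part 1.
  Removing a smallest part 1 or 2 thus leaves exactly the lower bounds 3 and 5, each one more than
  an even shift.\<close>

lemma D_gap_1: "D_gap (Suc 0) b \<longleftrightarrow> b \<ge> 3"
proof -
  have "b \<ge> 3 \<Longrightarrow> even b \<Longrightarrow> b \<ge> 4" by presburger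
  then show ?thesis by (auto simp: D_gap_def)
qed

lemma D_gap_2: "D_gap 2 b \<longleftrightarrow> b \<ge> 5"
  by (auto simp: D_gap_def)

lemma parts_D22_altdef:
  "parts_D22 n m =
     {ps. length ps = m \<and> sum_list ps = n \<and> sorted_wrt D_gap ps \<and> (\<forall>p\<in>set ps. p > 0)}"
proof -
  have "sorted ps" if "sorted_wrt D_gap ps" for ps
    using that by (rule sorted_wrt_mono_rel[rotated]) (auto simp: D_gap_def)
  then show ?thesis
    unfolding parts_D22_def partitions_into_def
    by (auto simp: sorted_wrt_iff_nth_Suc_transp[OF transp_D_gap] D_gap_def)
qed

definition parts_D22_ge :: "nat \<Rightarrow> nat \<Rightarrow> nat \<Rightarrow> nat list set" where
  "parts_D22_ge c n m = {ps \<in> parts_D22 n m. \<forall>p\<in>set ps. p \<ge> c}"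

lemma finite_parts_D22_ge: "finite (parts_D22_ge c n m)"
  using finite_parts_D22 by (simp add: parts_D22_ge_def)

lemma sum_list_map_add_const: "(\<Sum>p\<leftarrow>ps. p + (k::nat)) = sum_list ps + k * length ps"
  by (induction ps) auto

text \<open>Subtracting \<open>k\<close> turns the lower bound \<open>Suc k\<close> into positivity,
  and an even \<open>k\<close> keeps the parities that the gap condition sees.\<close>

lemma parts_D22_ge_shift:
  assumes "even k"
  shows "parts_D22_ge (Suc k) (n + k * m) m = map (\<lambda>p. p + k) ` parts_D22 n m"
proof (intro set_eqI iffI)
  fix ps assume ps: "ps \<in> parts_D22_ge (Suc k) (n + k * m) m"
  define qs where "qs = map (\<lambda>p. p - k) ps"
  have ge: "\<forall>p\<in>set ps. p \<ge> Suc k"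
    using ps by (simp add: parts_D22_ge_def)
  have eq: "map (\<lambda>p. p + k) qs = ps"
    using ge by (auto simp: qs_def intro!: map_idI)
  have "length qs = m" "sorted_wrt D_gap qs"
    using ps assms unfolding eq[symmetric]
    by (simp_all add: parts_D22_ge_def parts_D22_altdef sorted_wrt_map D_gap_add_even)
  moreover have "sum_list qs = n"
    using ps \<open>length qs = m\<close> unfolding eq[symmetric]
    by (simp add: parts_D22_ge_def parts_D22_altdef sum_list_map_add_const)
  moreover have "\<forall>p\<in>set qs. p > 0"
    using ge by (auto simp: qs_def)
  ultimately have "qs \<in> parts_D22 n m"
    by (simp add: parts_D22_altdef)
  with eq show "ps \<in> map (\<lambda>p. p + k) ` parts_D22 n m"
    by blast
next
  fix ps assume "ps \<in> map (\<lambda>p. p + k) ` parts_D22 n m"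
  with assms show "ps \<in> parts_D22_ge (Suc k) (n + k * m) m"
    by (auto simp: parts_D22_ge_def parts_D22_altdef sorted_wrt_map D_gap_add_even
        sum_list_map_add_const Suc_le_eq)
qed

lemma parts_D22_ge_empty:
  assumes "n < k * m"
  shows "parts_D22_ge (Suc k) n m = {}"
proof -
  have "k * length ps \<le> sum_list ps" if "\<forall>p\<in>set ps. Suc k \<le> p" for ps
    using that by (induction ps) auto
  then show ?thesis
    using assms by (fastforce simp: parts_D22_ge_def parts_D22_altdef)
qed

lemma card_parts_D22_ge:
  assumes "even k"
  shows "card (parts_D22_ge (Suc k) n m) = (if n < k * m then 0 else D22 (n - k * m) m)"
proof (cases "n < k * m")
  case False
  then have "n = (n - k * m) + k * m" by simp
  then have "card (parts_D22_ge (Suc k) n m) = card (map (\<lambda>p. p + k) ` parts_D22 (n - k * m) m)"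
    using parts_D22_ge_shift[OF assms] by metis
  also have "\<dots> = D22 (n - k * m) m"
    unfolding D22_def by (intro card_image inj_onI) (auto simp: inj_on_def dest: map_injective)
  finally show ?thesis using False by simp
qed (simp add: parts_D22_ge_empty)

lemma D21_eq_card: "D21 n m = card (parts_D22_ge 3 n m)"
  by (simp add: D21_def parts_D22_ge_def)

section \<open>Recurrence in the number of parts\<close>

lemma D22_Suc:
  "D22 n (Suc m) = (if n < 1 then 0 else card (parts_D22_ge 3 (n - 1) m))
     + (if n < 2 then 0 else card (parts_D22_ge 5 (n - 2) m))
     + card (parts_D22_ge 3 n (Suc m))"
proof -
  \<comment> \<open>Smallest part \<open>c\<close>, the others at least \<open>d\<close>. Without
    the empty case, truncation to \<open>n - c = 0\<close> would admit \<open>[c]\<close> as a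
    partition of \<open>n < c\<close> when \<open>m = 0\<close>.\<close>
  define P where "P c d = (if n < c then {} else (#) c ` parts_D22_ge d (n - c) m)" for c d
  have "parts_D22 n (Suc m) = P 1 3 \<union> P 2 5 \<union> parts_D22_ge 3 n (Suc m)"
  proof (intro set_eqI iffI)
    fix ps assume ps: "ps \<in> parts_D22 n (Suc m)"
    then obtain p qs where [simp]: "ps = p # qs"
      by (cases ps) (auto simp: parts_D22_altdef)
    have "p > 0" "\<forall>r\<in>set qs. D_gap p r"
      using ps by (auto simp: parts_D22_altdef)
    then consider "p = 1" | "p = 2" | "p \<ge> 3" "\<forall>r\<in>set qs. r \<ge> 3"
      by (fastforce simp: D_gap_def)
    then show "ps \<in> P 1 3 \<union> P 2 5 \<union> parts_D22_ge 3 n (Suc m)"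
      by cases (use ps in \<open>auto simp: P_def parts_D22_ge_def parts_D22_altdef D_gap_1 D_gap_2\<close>)
  qed (auto simp: P_def parts_D22_ge_def parts_D22_altdef D_gap_1 D_gap_2
      simp del: sum_list_eq_0_iff split: if_splits)
  moreover have "finite (P c d)" for c d
    by (simp add: P_def finite_parts_D22_ge)
  moreover have "P 1 3 \<inter> P 2 5 = {}" "(P 1 3 \<union> P 2 5) \<inter> parts_D22_ge 3 n (Suc m) = {}"
    by (auto simp: P_def parts_D22_ge_def)
  ultimately have "D22 n (Suc m) = card (P 1 3) + card (P 2 5) + card (parts_D22_ge 3 n (Suc m))"
    unfolding D22_def by (simp add: card_Un_disjoint finite_parts_D22_ge)
  moreover have "card (P c d) = (if n < c then 0 else card (parts_D22_ge d (n - c) m))" for c d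
    by (simp add: P_def card_image)
  ultimately show ?thesis by simp
qed

lemma D22_0: "D22 n 0 = (if n = 0 then 1 else 0)"
proof -
  have "parts_D22 n 0 = (if n = 0 then {[]} else {})"
    by (auto simp: parts_D22_altdef)
  then show ?thesis by (simp add: D22_def)
qed

definition D22_fps :: "nat \<Rightarrow> 'a :: comm_ring_1 fps" where
  "D22_fps m = Abs_fps (\<lambda>n. of_nat (D22 n m))"

lemma D22_fps_0: "D22_fps 0 = 1"
  by (simp add: D22_fps_def fps_eq_iff D22_0)

lemma parts_D22_ge_fps:
  assumes "even k"
  shows "Abs_fps (\<lambda>n. of_nat (card (parts_D22_ge (Suc k) n m))) = fps_X ^ (k * m) * D22_fps m"
  by (simp add: fps_eq_iff D22_fps_def fps_X_power_mult_nth card_parts_D22_ge[OF assms])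

lemma D21_fps: "Abs_fps (\<lambda>n. of_nat (D21 n m)) = fps_X ^ (2 * m) * D22_fps m"
  using parts_D22_ge_fps[of 2 m] by (simp add: D21_eq_card numeral_3_eq_3 numeral_2_eq_2)

text \<open>With \<open>u = fps_X ^ (2 * m + 1)\<close>, a smallest part 1 followed by
  \<open>m\<close> parts shifted by 2 has weight \<open>u\<close>, and a smallest part 2 followed by
  \<open>m\<close> parts shifted by 4 has weight \<open>u\<^sup>2\<close>. The remaining case is a
  multiple of the left-hand series and moves to the left.\<close>

lemma D22_fps_Suc:
  "D22_fps (Suc m) * (1 - fps_X ^ (2 * Suc m)) =
     fps_X ^ (2 * m + 1) * (1 + fps_X ^ (2 * m + 1)) * (D22_fps m :: 'a :: comm_ring_1 fps)"
proof -
  define G :: "nat \<Rightarrow> nat \<Rightarrow> 'a fps"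
    where "G c m = Abs_fps (\<lambda>n. of_nat (card (parts_D22_ge c n m)))" for c m
  have "D22_fps (Suc m) = fps_X ^ 1 * G 3 m + fps_X ^ 2 * G 5 m + G 3 (Suc m)"
    unfolding fps_eq_iff fps_add_nth fps_X_power_mult_nth
    by (simp add: D22_fps_def G_def D22_Suc del: One_nat_def)
  moreover have "G 3 m' = fps_X ^ (2 * m') * D22_fps m'" "G 5 m' = fps_X ^ (4 * m') * D22_fps m'" for m'
    using parts_D22_ge_fps[of 2 m'] parts_D22_ge_fps[of 4 m'] by (simp_all add: G_def)
  ultimately have "D22_fps (Suc m) = fps_X ^ 1 * (fps_X ^ (2 * m) * D22_fps m)
      + fps_X ^ 2 * (fps_X ^ (4 * m) * D22_fps m) + fps_X ^ (2 * Suc m) * (D22_fps (Suc m) :: 'a fps)"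
    by simp
  moreover define u :: "'a fps" where "u = fps_X ^ (2 * m + 1)"
  define v :: "'a fps" where "v = fps_X ^ (2 * Suc m)"
  have "fps_X ^ 2 * (fps_X ^ (4 * m) * D22_fps m) = u * (u * D22_fps m)"
    unfolding u_def mult.assoc[symmetric] power_add[symmetric]
    by (intro arg_cong2[where f = "(*)"] arg_cong[where f = "power _"] refl) simp
  moreover have "fps_X ^ 1 * (fps_X ^ (2 * m) * D22_fps m) = u * D22_fps m"
    unfolding u_def mult.assoc[symmetric] power_add[symmetric] by (simp add: add.commute)
  ultimately have "D22_fps (Suc m) = u * D22_fps m + u * (u * D22_fps m) + v * D22_fps (Suc m)"
    by (simp only: v_def)
  then have "D22_fps (Suc m) - v * D22_fps (Suc m) = u * D22_fps m + u * (u * D22_fps m)"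
    by (simp only: diff_eq_eq)
  then show ?thesis
    unfolding u_def[symmetric] v_def[symmetric] by (simp add: algebra_simps)
qed

lemma D22_eq_0: "n < m \<Longrightarrow> D22 n m = 0"
proof -
  assume "n < m"
  moreover have "length ps \<le> sum_list ps" if "\<forall>p\<in>set ps. (p::nat) > 0" for ps
    using that by (induction ps) auto
  ultimately have "parts_D22 n m = {}"
    by (fastforce simp: parts_D22_altdef)
  then show ?thesis by (simp add: D22_def)
qed

section \<open>Functional equations for the double sum\<close>

lemma sum_weighted_antidiagonal:
  fixes f g :: "nat \<Rightarrow> 'a :: comm_ring_1"
  shows "(\<Sum>(i, j) | i + 2 * j = m. f i * g j) =
    (Abs_fps f * Abs_fps (\<lambda>n. if even n then g (n div 2) else 0)) $ m"
proof -
  have "(\<Sum>(i, j) | i + 2 * j = m. f i * g j) = (\<Sum>i | i \<le> m \<and> even (m - i). f i * g ((m - i) div 2))"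
    by (rule sum.reindex_bij_witness[of _ "\<lambda>i. (i, (m - i) div 2)" fst]) auto
  also have "\<dots> = (\<Sum>i=0..m. f i * (if even (m - i) then g ((m - i) div 2) else 0))"
    by (rule sum.mono_neutral_cong_left) auto
  finally show ?thesis by (simp add: fps_mult_nth)
qed

text \<open>Only the recurrences of the two sequences enter, so no quotient occurs here. In the
  proof \<open>fps_X\<close> is a separate marker z over the ring containing \<open>q\<close>, and
  the claim is read off at z^(m+1).\<close>

lemma weighted_antidiagonal_sum_Suc:
  fixes f g :: "nat \<Rightarrow> 'a :: idom" and q :: 'a
  assumes f: "\<And>n. f (Suc n) * (1 - q ^ Suc n) = q ^ n * f n"
    and g: "\<And>n. g (Suc n) * (1 - q ^ (4 * Suc n)) = g n"
  defines "S \<equiv> \<lambda>m. \<Sum>(i, j) | i + 2 * j = m. f i * g j"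
  shows "S (Suc m) * (1 - q ^ (2 * Suc m)) = (1 + q ^ (2 * m + 1)) * S m"
proof -
  define F where "F = Abs_fps f"
  define G where "G = Abs_fps (\<lambda>n. if even n then g (n div 2) else 0)"
  \<comment> \<open>The substitution of cz for z.\<close>
  define d where "d c h = h oo (fps_const c * fps_X)" for c :: 'a and h :: "'a fps"
  have d_nth: "d c h $ n = c ^ n * h $ n" for c h n
    by (simp add: d_def)
  have d_mult: "d c (h * k) = d c h * d c k" for c h k
    by (simp add: d_def fps_compose_mult_distrib)
  have F1: "F = (1 + fps_X) * d q F"
  proof (rule fps_ext)
    fix n show "F $ n = ((1 + fps_X) * d q F) $ n"
      using f[of "n - 1"] by (cases n) (simp_all add: F_def d_nth algebra_simps)
  qed
  \<comment> \<open>This is \<open>F1\<close> with qz for z, checked by scaling the n-th coefficient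
    by \<open>q ^ n\<close>.\<close>
  have "d q F = (1 + fps_const q * fps_X) * d (q\<^sup>2) F"
  proof (rule fps_ext)
    fix n
    have "q ^ n * F $ n = q ^ n * ((1 + fps_X) * d q F) $ n"
      using F1 by simp
    then show "d q F $ n = ((1 + fps_const q * fps_X) * d (q\<^sup>2) F) $ n"
      by (cases n) (simp_all add: d_nth algebra_simps power_mult_distrib power2_eq_square)
  qed
  with F1 have F2: "F = (1 + fps_X) * (1 + fps_const q * fps_X) * d (q\<^sup>2) F"
    by (simp add: mult.assoc)
  have G2: "(1 - fps_X ^ 2) * G = d (q\<^sup>2) G"
  proof (rule fps_ext)
    fix n
    show "((1 - fps_X ^ 2) * G) $ n = d (q\<^sup>2) G $ n"
    proof (cases "even n \<and> n \<ge> 2")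
      case True
      \<comment> \<open>Only at positive even indices does the hypothesis on \<open>g\<close> come
        in; there \<open>q\<^sup>2\<close> raised to \<open>n\<close> is the power of
        \<open>q\<close> occurring in it.\<close>
      then obtain k where n: "n = 2 * Suc k"
        by (metis dvdE mult_0_right not0_implies_Suc not_numeral_le_zero)
      have "(q\<^sup>2) ^ n = q ^ (4 * Suc k)"
        unfolding n power_mult[symmetric] by (rule arg_cong[where f = "power _"]) simp
      then show ?thesis
        using g[of k] n
        by (simp add: left_diff_distrib fps_X_power_mult_nth G_def d_nth algebra_simps del: power_Suc)
    next
      case False
      then have "odd n \<or> n = 0" by presburger
      then show ?thesis
        by (auto simp: left_diff_distrib fps_X_power_mult_nth G_def d_nth)
    qed
  qed
  \<comment> \<open>Since 1 - z^2 = (1 + z)(1 - z), the equations for \<open>F\<close> and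
    \<open>G\<close> share the factor 1 + z, which cancels over an integral domain.\<close>
  have "(1 + fps_X) * ((1 - fps_X) * (F * G)) = F * ((1 - fps_X ^ 2) * G)"
    by (simp add: algebra_simps power2_eq_square)
  also have "\<dots> = (1 + fps_X) * ((1 + fps_const q * fps_X) * d (q\<^sup>2) (F * G))"
    unfolding G2 by (subst F2) (simp add: d_mult mult.assoc)
  finally have "(1 + fps_X) * ((1 - fps_X) * (F * G)) =
    (1 + fps_X) * ((1 + fps_const q * fps_X) * d (q\<^sup>2) (F * G))" .
  moreover have "(1 + fps_X :: 'a fps) \<noteq> 0"
    by (rule fps_nonzeroI[of _ 0]) simp
  ultimately have "(1 - fps_X) * (F * G) = (1 + fps_const q * fps_X) * d (q\<^sup>2) (F * G)"
    by (metis mult_left_cancel)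
  then have "((1 - fps_X) * (F * G)) $ Suc m = ((1 + fps_const q * fps_X) * d (q\<^sup>2) (F * G)) $ Suc m"
    by simp
  moreover have "S k = (F * G) $ k" for k
    unfolding S_def F_def G_def by (rule sum_weighted_antidiagonal)
  ultimately have "S (Suc m) - S m = (q\<^sup>2) ^ Suc m * S (Suc m) + q * (q\<^sup>2) ^ m * S m"
    by (simp add: left_diff_distrib distrib_right d_nth mult.assoc del: power_Suc)
  then have "S (Suc m) - S m = q ^ (2 * Suc m) * S (Suc m) + q ^ (2 * m + 1) * S m"
    by (simp only: power_mult power_add power_one_right mult.commute[of _ q])
  then show ?thesis
    by (simp add: algebra_simps del: power_Suc)
qed

section \<open>Denominators, exponents and the coefficient of x^m\<close>

lemma q_poch_0 [simp]: "q_poch a q 0 = 1"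
  by (simp add: q_poch_def)

lemma q_poch_Suc: "q_poch a q (Suc n) = q_poch a q n * (1 - a * q ^ n)"
  by (simp add: q_poch_def)

lemma q_poch_nth_0: "a $ 0 = 0 \<Longrightarrow> q_poch a q n $ 0 = 1"
  by (induction n) (simp_all add: q_poch_Suc)

lemma fps_fps_divide_eqI:
  fixes f g h :: "rat fps fps"
  assumes "g $ 0 = 1" "h * g = f"
  shows "f / g = h"
proof -
  have "g \<noteq> 0"
    using assms by (intro fps_nonzeroI[of _ 0]) simp
  moreover have "f / g * g = h * g"
    using fps_fps_divide_mult_cancel[of g f] assms by simp
  ultimately show ?thesis by simp
qed

text \<open>The square depends only on the number of parts m = i + 2j, and the rest only on
  \<open>i\<close>, so the summand factors. The square is the size of the least admissible partition
  1 + 3 + ... + (2m - 1).\<close>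

lemma D22_exponent_eq:
  "4 * j\<^sup>2 + (3 * i\<^sup>2 - i) div 2 + 4 * j * i = (i + 2 * j)\<^sup>2 + i * (i - 1) div (2::nat)"
proof -
  have "3 * i\<^sup>2 - i = i * (i - 1) + i\<^sup>2 * 2"
    by (cases i) (simp_all add: power2_eq_square algebra_simps)
  then have "(3 * i\<^sup>2 - i) div 2 = i * (i - 1) div 2 + i\<^sup>2"
    by simp
  then show ?thesis
    by (simp add: power2_eq_square algebra_simps)
qed

text \<open>The surplus is twice the number of parts, the cost of raising every part by 2 as in
  \<open>D21_fps\<close>.\<close>

lemma D21_exponent_eq:
  "4 * j\<^sup>2 + 4 * j + (3 * i\<^sup>2 + 3 * i) div 2 + 4 * j * i =
     2 * (i + 2 * j) + (4 * j\<^sup>2 + (3 * i\<^sup>2 - i) div 2 + 4 * j * (i::nat))"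
proof -
  have "i \<le> 3 * i\<^sup>2"
    by (cases i) (simp_all add: power2_eq_square)
  then have "3 * i\<^sup>2 + 3 * i = (3 * i\<^sup>2 - i) + 2 * i * 2"
    by simp
  then have "(3 * i\<^sup>2 + 3 * i) div 2 = (3 * i\<^sup>2 - i) div 2 + 2 * i"
    by simp
  then show ?thesis by simp
qed

text \<open>Once \<open>var_q ^ m\<^sup>2\<close> is split off, both sides obey the same first-order
  recurrence and start at 1. The growth of the square by \<open>2 * m + 1\<close> supplies the power
  of q in \<open>D22_fps_Suc\<close>.\<close>

lemma D22_fps_eq_sum:
  "D22_fps m = (\<Sum>(i, j) | i + 2 * j = m.
     var_q ^ (4 * j\<^sup>2 + (3 * i\<^sup>2 - i) div 2 + 4 * j * i)
       / (q_poch var_q var_q i * q_poch (var_q ^ 4) (var_q ^ 4) j))"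
proof -
  define P where "P = q_poch var_q var_q"
  define Q where "Q = q_poch (var_q ^ 4) (var_q ^ 4)"
  define f where "f i = var_q ^ (i * (i - 1) div 2) / P i" for i
  define g where "g j = 1 / Q j" for j
  have P0: "P i $ 0 = 1" and Q0: "Q i $ 0 = 1" for i
    by (simp_all add: P_def Q_def q_poch_nth_0)
  have f_mult: "f i * P i = var_q ^ (i * (i - 1) div 2)" for i
    unfolding f_def by (rule fps_fps_divide_mult_cancel[OF P0])
  have g_mult: "g j * Q j = 1" for j
    unfolding g_def by (rule fps_fps_divide_mult_cancel[OF Q0])
  have f_Suc: "f (Suc n) * (1 - var_q ^ Suc n) = var_q ^ n * f n" for n
  proof -
    have "f (Suc n) * (1 - var_q ^ Suc n) * P n = f (Suc n) * P (Suc n)"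
      by (simp add: P_def q_poch_Suc mult_ac)
    also have "\<dots> = var_q ^ (Suc n * (Suc n - 1) div 2)"
      by (rule f_mult)
    also have "Suc n * (Suc n - 1) div 2 = n + n * (n - 1) div 2"
    proof -
      have "Suc n * (Suc n - 1) = n * (n - 1) + n * 2"
        by (cases n) simp_all
      then show ?thesis by simp
    qed
    also have "var_q ^ (n + n * (n - 1) div 2) = var_q ^ n * f n * P n"
      by (simp add: power_add mult.assoc f_mult)
    finally show ?thesis
      using P0[of n] by (metis fps_nonzeroI mult_right_cancel zero_neq_one)
  qed
  have g_Suc: "g (Suc n) * (1 - var_q ^ (4 * Suc n)) = g n" for n
  proof -
    have "g (Suc n) * (1 - var_q ^ (4 * Suc n)) * Q n = g (Suc n) * Q (Suc n)"
      unfolding Q_def q_poch_Suc power_mult power_Suc by (simp only: mult_ac)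
    also have "\<dots> = g n * Q n"
      by (simp only: g_mult)
    finally show ?thesis
      using Q0[of n] by (metis fps_nonzeroI mult_right_cancel zero_neq_one)
  qed
  define S where "S m = (\<Sum>(i, j) | i + 2 * j = m. f i * g j)" for m
  have S_Suc: "S (Suc m) * (1 - var_q ^ (2 * Suc m)) = (1 + var_q ^ (2 * m + 1)) * S m" for m
    unfolding S_def by (rule weighted_antidiagonal_sum_Suc[OF f_Suc g_Suc])
  have "D22_fps m = var_q ^ m\<^sup>2 * S m"
  proof (induction m)
    case 0
    have "{(i, j). i + 2 * j = (0::nat)} = {(0, 0)}" by auto
    moreover have "f 0 = 1" "g 0 = 1"
      using f_mult[of 0] g_mult[of 0] by (simp_all add: P_def Q_def)
    ultimately show ?case by (simp add: S_def D22_fps_0)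
  next
    case (Suc m)
    have "D22_fps (Suc m) * (1 - var_q ^ (2 * Suc m)) =
        var_q ^ (2 * m + 1) * (1 + var_q ^ (2 * m + 1)) * (var_q ^ m\<^sup>2 * S m)"
      by (simp only: D22_fps_Suc Suc.IH)
    also have "\<dots> = var_q ^ (m\<^sup>2 + (2 * m + 1)) * ((1 + var_q ^ (2 * m + 1)) * S m)"
      by (simp only: power_add mult_ac)
    also have "m\<^sup>2 + (2 * m + 1) = (Suc m)\<^sup>2"
      by (simp add: power2_eq_square)
    also have "var_q ^ (Suc m)\<^sup>2 * ((1 + var_q ^ (2 * m + 1)) * S m) =
        var_q ^ (Suc m)\<^sup>2 * S (Suc m) * (1 - var_q ^ (2 * Suc m))"
      by (simp only: S_Suc[symmetric] mult.assoc)
    finally have "D22_fps (Suc m) * (1 - var_q ^ (2 * Suc m)) =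
        var_q ^ (Suc m)\<^sup>2 * S (Suc m) * (1 - var_q ^ (2 * Suc m))" .
    moreover have "1 - var_q ^ (2 * Suc m) \<noteq> 0"
      by (rule fps_nonzeroI[of _ 0]) simp
    ultimately show ?case
      using mult_right_cancel by blast
  qed
  also have "\<dots> = (\<Sum>(i, j) | i + 2 * j = m.
     var_q ^ (4 * j\<^sup>2 + (3 * i\<^sup>2 - i) div 2 + 4 * j * i) / (P i * Q j))"
    unfolding S_def sum_distrib_left
  proof (intro sum.cong refl, clarify)
    fix i j
    assume m: "m = i + 2 * j"
    have "var_q ^ (i + 2 * j)\<^sup>2 * (f i * g j) * (P i * Q j) =
        var_q ^ (i + 2 * j)\<^sup>2 * (f i * P i) * (g j * Q j)"
      by (simp only: mult_ac)
    also have "\<dots> = var_q ^ (4 * j\<^sup>2 + (3 * i\<^sup>2 - i) div 2 + 4 * j * i)"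
      unfolding D22_exponent_eq f_mult g_mult by (simp add: power_add)
    finally show "var_q ^ (i + 2 * j)\<^sup>2 * (f i * g j) =
        var_q ^ (4 * j\<^sup>2 + (3 * i\<^sup>2 - i) div 2 + 4 * j * i) / (P i * Q j)"
      by (intro fps_fps_divide_eqI[symmetric]) (simp_all add: P0 Q0)
  qed
  finally show ?thesis
    by (simp only: P_def Q_def)
qed

section \<open>q-adic summation of the double series\<close>

lemma has_sum_fpsI_superset:
  fixes F :: "'a \<Rightarrow> 'b :: comm_ring_1 fps"
  assumes "\<And>n. finite (B n)"
    and "\<And>n x. x \<notin> B n \<Longrightarrow> F x $ n = 0"
    and "\<And>n. S $ n = (\<Sum>x\<in>B n. F x $ n)"
  shows "(F has_sum S) UNIV"
proof (rule has_sum_fpsI)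
  fix n
  show "finite {x \<in> UNIV. F x $ n \<noteq> 0}"
    by (rule finite_subset[OF _ assms(1)[of n]]) (use assms(2) in blast)
  show "S $ n = (\<Sum>x | x \<in> UNIV \<and> F x $ n \<noteq> 0. F x $ n)"
    unfolding assms(3) by (rule sum.mono_neutral_right) (use assms(1,2) in auto)
qed

text \<open>Collecting terms by the exponent m of x leaves one identity in q for each m. By
  \<open>d\<close> and \<open>t\<close>, only m \<le> k contributes to q^k, so every coefficient is
  a finite sum.\<close>

lemma has_sum_weighted_pairs:
  fixes t :: "nat \<Rightarrow> nat \<Rightarrow> rat fps fps" and d :: "nat \<Rightarrow> nat \<Rightarrow> nat"
  assumes d: "\<And>n m. n < m \<Longrightarrow> d n m = 0"
    and t: "\<And>i j k. k < i + 2 * j \<Longrightarrow> t i j $ k = 0"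
    and eq: "\<And>m. Abs_fps (\<lambda>n. of_nat (d n m)) = (\<Sum>(i, j) | i + 2 * j = m. t i j)"
  shows "\<exists>F. ((\<lambda>(m, n). of_nat (d n m) * var_q ^ n * var_x ^ m) has_sum F) UNIV \<and>
    ((\<lambda>(i, j). t i j * var_x ^ (2 * j + i)) has_sum F) UNIV"
proof -
  define F where "F = Abs_fps (\<lambda>k. \<Sum>m\<le>k. of_nat (d k m) * (fps_X :: rat fps) ^ m)"
  have nth1: "(of_nat (d n m) * var_q ^ n * var_x ^ m) $ k =
      (if n = k then of_nat (d n m) * fps_X ^ m else 0)" for m n k
    by (simp add: fps_const_power fps_of_nat[symmetric] fps_X_power_nth)
  have nth2: "(t i j * var_x ^ m) $ k = t i j $ k * fps_X ^ m" for i j m k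
    by (simp add: fps_const_power)
  have fin: "finite {(i, j). i + 2 * j = m}" for m :: nat
    by (rule finite_subset[of _ "{..m} \<times> {..m}"]) auto
  have "((\<lambda>(m, n). of_nat (d n m) * var_q ^ n * var_x ^ m) has_sum F) UNIV"
  proof (rule has_sum_fpsI_superset[of "\<lambda>k. (\<lambda>m. (m, k)) ` {..k}"])
    fix k
    show "F $ k = (\<Sum>p\<in>(\<lambda>m. (m, k)) ` {..k}.
        (case p of (m, n) \<Rightarrow> of_nat (d n m) * var_q ^ n * var_x ^ m) $ k)"
      by (subst sum.reindex) (simp_all add: inj_on_def nth1 F_def)
  qed (auto simp: nth1 d image_iff)
  moreover have "((\<lambda>(i, j). t i j * var_x ^ (2 * j + i)) has_sum F) UNIV"
  \<comment> \<open>The pairs of weight at most \<open>k\<close>, split into finite disjoint fibres;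
    heavier pairs vanish by \<open>t\<close>.\<close>
  proof (rule has_sum_fpsI_superset[of "\<lambda>k. \<Union>m\<le>k. {(i, j). i + 2 * j = m}"])
    fix k
    have "(\<Sum>p\<in>(\<Union>m\<le>k. {(i, j). i + 2 * j = m}). (case p of (i, j) \<Rightarrow> t i j * var_x ^ (2 * j + i)) $ k)
        = (\<Sum>m\<le>k. \<Sum>p | fst p + 2 * snd p = m. t (fst p) (snd p) $ k * fps_X ^ m)"
      by (subst sum.UNION_disjoint) (auto simp: fin nth2 add.commute intro!: sum.cong)
    also have "\<dots> = (\<Sum>m\<le>k. (\<Sum>(i, j) | i + 2 * j = m. t i j) $ k * fps_X ^ m)"
      by (simp add: fps_sum_nth sum_distrib_right case_prod_unfold)
    also have "\<dots> = F $ k"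
      by (simp add: eq[symmetric] F_def)
    finally show "F $ k = (\<Sum>p\<in>(\<Union>m\<le>k. {(i, j). i + 2 * j = m}).
        (case p of (i, j) \<Rightarrow> t i j * var_x ^ (2 * j + i)) $ k)" ..
  next
    show "(case p of (i, j) \<Rightarrow> t i j * var_x ^ (2 * j + i)) $ k = 0"
      if "p \<notin> (\<Union>m\<le>k. {(i, j). i + 2 * j = m})" for k p
    proof -
      obtain i j where p: "p = (i, j)" by fastforce
      have "k < i + 2 * j"
        by (rule ccontr) (use that p in auto)
      then show ?thesis by (simp add: p nth2 t)
    qed
  qed (simp add: fin)
  ultimately show ?thesis by blast
qed

text \<open>The exponent is at least m^2 \<ge> m for m = i + 2j. This gives the vanishing of low
  coefficients required for summation.\<close>

lemma weight_le_D22_exponent: "i + 2 * j \<le> 4 * j\<^sup>2 + (3 * i\<^sup>2 - i) div 2 + 4 * j * (i::nat)"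
  unfolding D22_exponent_eq by (simp add: power2_eq_square trans_le_add1)

theorem theorem13:
  shows "(\<exists>F.
      ((\<lambda>(m, n). of_nat (D22 n m) * var_q ^ n * var_x ^ m) has_sum F) UNIV \<and>
      ((\<lambda>(n1, n2).
          var_q ^ (4 * n2\<^sup>2 + (3 * n1\<^sup>2 - n1) div 2 + 4 * n2 * n1) * var_x ^ (2 * n2 + n1)
            / (q_poch var_q var_q n1 * q_poch (var_q ^ 4) (var_q ^ 4) n2)) has_sum F) UNIV) \<and>
    (\<exists>F.
      ((\<lambda>(m, n). of_nat (D21 n m) * var_q ^ n * var_x ^ m) has_sum F) UNIV \<and>
      ((\<lambda>(n1, n2).
          var_q ^ (4 * n2\<^sup>2 + 4 * n2 + (3 * n1\<^sup>2 + 3 * n1) div 2 + 4 * n2 * n1) * var_x ^ (2 * n2 + n1)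
            / (q_poch var_q var_q n1 * q_poch (var_q ^ 4) (var_q ^ 4) n2)) has_sum F) UNIV)"
proof -
  define P where "P i j = q_poch var_q var_q i * q_poch (var_q ^ 4) (var_q ^ 4) j" for i j
  define e where "e i j = 4 * j\<^sup>2 + (3 * i\<^sup>2 - i) div 2 + 4 * j * i" for i j :: nat
  define t where "t i j = var_q ^ e i j / P i j" for i j
  have P0: "P i j $ 0 = 1" for i j
    by (simp add: P_def q_poch_nth_0)
  have t_mult: "t i j * P i j = var_q ^ e i j" for i j
    unfolding t_def by (rule fps_fps_divide_mult_cancel[OF P0])
  have t_nth: "t i j $ k = 0" if "k < i + 2 * j" for i j k
  proof -
    \<comment> \<open>Pulling the power of q out of the quotient exposes the order in q.\<close>
    have "t i j = var_q ^ e i j * (1 / P i j)"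
      unfolding t_def using fps_fps_divide_mult_cancel[OF P0[of i j], of 1]
      by (intro fps_fps_divide_eqI P0) (simp add: mult.assoc)
    moreover have "k < e i j"
      using that weight_le_D22_exponent[of i j] by (simp add: e_def)
    ultimately show ?thesis by (simp add: fps_X_power_mult_nth)
  qed
  have D22: "D22_fps m = (\<Sum>(i, j) | i + 2 * j = m. t i j)" for m
    unfolding t_def e_def P_def by (rule D22_fps_eq_sum)
  have "\<exists>F. ((\<lambda>(m, n). of_nat (D22 n m) * var_q ^ n * var_x ^ m) has_sum F) UNIV \<and>
      ((\<lambda>(i, j). t i j * var_x ^ (2 * j + i)) has_sum F) UNIV"
    by (rule has_sum_weighted_pairs) (simp_all add: D22_eq_0 t_nth D22 flip: D22_fps_def)
  moreover have "t i j * var_x ^ (2 * j + i) = var_q ^ e i j * var_x ^ (2 * j + i) / P i j" for i j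
    by (intro fps_fps_divide_eqI[symmetric] P0) (simp add: t_mult[symmetric] mult_ac)
  moreover have "\<exists>F. ((\<lambda>(m, n). of_nat (D21 n m) * var_q ^ n * var_x ^ m) has_sum F) UNIV \<and>
      ((\<lambda>(i, j). var_q ^ (2 * (i + 2 * j)) * t i j * var_x ^ (2 * j + i)) has_sum F) UNIV"
  proof (rule has_sum_weighted_pairs)
    show "D21 n m = 0" if "n < m" for n m
      using card_parts_D22_ge[of 2 n m] D22_eq_0 that by (simp add: D21_eq_card)
    \<comment> \<open>The leading power of q already has order at least
      \<open>i + 2 * j\<close>.\<close>
    show "(var_q ^ (2 * (i + 2 * j)) * t i j) $ k = 0" if "k < i + 2 * j" for i j k
      using that by (simp add: fps_X_power_mult_nth)
    show "Abs_fps (\<lambda>n. of_nat (D21 n m)) = (\<Sum>(i, j) | i + 2 * j = m. var_q ^ (2 * (i + 2 * j)) * t i j)" for m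
      unfolding D21_fps D22 sum_distrib_left by (intro sum.cong) auto
  qed
  moreover have "var_q ^ (2 * (i + 2 * j)) * t i j * var_x ^ (2 * j + i) =
      var_q ^ (4 * j\<^sup>2 + 4 * j + (3 * i\<^sup>2 + 3 * i) div 2 + 4 * j * i) * var_x ^ (2 * j + i) / P i j" for i j
    unfolding D21_exponent_eq e_def[symmetric]
    by (intro fps_fps_divide_eqI[symmetric] P0) (simp only: power_add t_mult[symmetric] mult_ac)
  ultimately show ?thesis
    unfolding e_def P_def by simp
qed

end
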